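(* Let $r>0$. The area $\mathrm{Area}(\mathcal{C}(r))$ of the circle (disc) of radius $r$ lying in the base plane and centred at the origin of the projective model of $\widetilde{\mathbf{SL}_2\mathbf{R}}$ geometry is $$\mathrm{Area}(\mathcal{C}(r))=\pi\int_0^r\sinh(2t)\,\mathrm{d}t=\pi\sinh^2(r).$$
   Context: In hyperboloid coordinates $(r,\theta,\phi)$, related to projective coordinates by $x^0=\cosh r\cos\phi$, $x^1=\cosh r\sin\phi$, $x^2=\sinh r\cos(\theta-\phi)$, $x^3=\sinh r\sin(\theta-\phi)$ (with $\phi$ extended to $\mathbf{R}$ to pass to the universal cover), the Riemannian metric of $\widetilde{\mathbf{SL}_2\mathbf{R}}$ is $$(\mathrm{d}s)^2=(\mathrm{d}r)^2+\cosh^2 r\,\sinh^2 r\,(\mathrm{d}\theta)^2+\bigl[\mathrm{d}\phi+\sinh^2 r\,\mathrm{d}\theta\bigr]^2,$$ with volume element $\mathrm{d}V=\tfrac12\sinh(2r)\,\mathrm{d}r\,\mathrm{d}\theta\,\mathrm{d}\phi$. The base plane is $\phi=0$. The disc of radius $r$ centred at the origin in the base plane is the set of points with coordinates $(t,\theta,0)$, $0\le t\le r$, $\theta\in(-\pi,\pi]$. Area convention: the area of a region $D$ in the base plane is the volume of the solid of fibre height $1$ over $D$, i.e. of $\{(t,\theta,\phi):(t,\theta,0)\in D,\ 0\le\phi\le1\}$; equivalently $\mathrm{Area}(D)=\int_D\frac12\sinh(2t)\,\mathrm{d}t\,\mathrm{d}\theta$. *)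

theory Defs
  imports "HOL-Analysis.Analysis"
begin

type_synonym coords = "real \<times> real \<times> real"  \<comment> \<open>hyperboloid coordinates \<open>(r, \<theta>, \<phi>)\<close>\<close>

text \<open>
  A point of the universal cover is encoded by its homogeneous coordinates, normalised by
  \<open>- x0\<^sup>2 - x1\<^sup>2 + x2\<^sup>2 + x3\<^sup>2 = -1\<close>, together with the lifted fibre angle \<open>\<phi>\<close>, which
  tells the sheets of the covering apart.
\<close>
type_synonym point = "(real \<times> real \<times> real \<times> real) \<times> real"

definition hyp :: "coords \<Rightarrow> point" where
  "hyp = (\<lambda>(r, \<theta>, \<phi>).
     ((cosh r * cos \<phi>, cosh r * sin \<phi>, sinh r * cos (\<theta> - \<phi>), sinh r * sin (\<theta> - \<phi>)), \<phi>))"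

definition coord_domain :: "coords set" where
  "coord_domain = {(r, \<theta>, \<phi>). 0 \<le> r \<and> -pi < \<theta> \<and> \<theta> \<le> pi}"

lemma hyp_eqD:
  assumes "hyp (r, \<theta>, \<phi>) = hyp (r', \<theta>', \<phi>')" "0 \<le> r" "0 \<le> r'"
  shows "r = r'" "\<phi> = \<phi>'"
proof -
  show "\<phi> = \<phi>'"
    using assms(1) by (simp add: hyp_def)
  then have "(cosh r * cos \<phi>)\<^sup>2 + (cosh r * sin \<phi>)\<^sup>2
           = (cosh r' * cos \<phi>)\<^sup>2 + (cosh r' * sin \<phi>)\<^sup>2"
    using assms(1) by (simp only: hyp_def prod.case prod.inject)
  then have "(cosh r)\<^sup>2 * ((cos \<phi>)\<^sup>2 + (sin \<phi>)\<^sup>2) = (cosh r')\<^sup>2 * ((cos \<phi>)\<^sup>2 + (sin \<phi>)\<^sup>2)"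
    by (simp only: power_mult_distrib distrib_left)
  then have "cosh r = cosh r'"
    using cosh_real_pos[of r] cosh_real_pos[of r'] by (simp add: power2_eq_iff)
  then show "r = r'"
    using assms(2,3) by (metis arcosh_cosh_real)
qed

lemma inj_on_hyp: "inj_on hyp {(r, \<theta>, \<phi>) \<in> coord_domain. 0 < r}"
proof (rule inj_onI, clarsimp simp: coord_domain_def)
  fix r \<theta> \<phi> r' \<theta>' \<phi>' :: real
  assume *: "hyp (r, \<theta>, \<phi>) = hyp (r', \<theta>', \<phi>')" "0 < r" "0 < r'"
    "- pi < \<theta>" "\<theta> \<le> pi" "- pi < \<theta>'" "\<theta>' \<le> pi"
  then have r: "r = r'" and \<phi>: "\<phi> = \<phi>'"
    using hyp_eqD by (meson less_imp_le)+
  have "cos (\<theta> - \<phi>) = cos (\<theta>' - \<phi>)" "sin (\<theta> - \<phi>) = sin (\<theta>' - \<phi>)"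
    using * r \<phi> by (simp_all add: hyp_def)
  then obtain n :: int where n: "\<theta> - \<phi> = \<theta>' - \<phi> + 2 * pi * n"
    by (metis sin_cos_eq_iff)
  then have "\<bar>2 * pi * n\<bar> < 2 * pi * 1"
    using * by linarith
  then have "\<bar>real_of_int n\<bar> < 1"
    by (simp add: abs_mult)
  then have "n = 0"
    by linarith
  then show "r = r' \<and> \<theta> = \<theta>' \<and> \<phi> = \<phi>'"
    using n r \<phi> by simp
qed

text \<open>
  The polarisation of \<open>ds\<^sup>2 = dr\<^sup>2 + cosh\<^sup>2 r sinh\<^sup>2 r d\<theta>\<^sup>2 + (d\<phi> + sinh\<^sup>2 r d\<theta>)\<^sup>2\<close>, applied to
  tangent vectors given by their components in the coordinate frame.
\<close>
definition metric :: "coords \<Rightarrow> coords \<Rightarrow> coords \<Rightarrow> real" where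
  "metric = (\<lambda>(r, \<theta>, \<phi>) (dr, d\<theta>, d\<phi>) (dr', d\<theta>', d\<phi>').
     dr * dr' + (cosh r)\<^sup>2 * (sinh r)\<^sup>2 * (d\<theta> * d\<theta>')
     + (d\<phi> + (sinh r)\<^sup>2 * d\<theta>) * (d\<phi>' + (sinh r)\<^sup>2 * d\<theta>'))"

definition coord_frame :: "3 \<Rightarrow> coords" where
  "coord_frame i = (if i = 1 then (1, 0, 0) else if i = 2 then (0, 1, 0) else (0, 0, 1))"

definition metric_matrix :: "coords \<Rightarrow> real^3^3" where
  "metric_matrix p = (\<chi> i j. metric p (coord_frame i) (coord_frame j))"

definition volume_element :: "coords \<Rightarrow> real" where
  "volume_element p = sqrt (det (metric_matrix p))"

lemma volume_element_eq:
  assumes "0 \<le> r"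
  shows "volume_element (r, \<theta>, \<phi>) = sinh (2 * r) / 2"
proof -
  have "det (metric_matrix (r, \<theta>, \<phi>)) = (cosh r * sinh r)\<^sup>2"
    by (simp add: det_3 metric_matrix_def metric_def coord_frame_def power_mult_distrib)
  moreover have "0 \<le> cosh r * sinh r"
    using assms by simp
  ultimately show ?thesis
    by (simp add: volume_element_def sinh_double)
qed

text \<open>
  The coordinates are injective on \<^const>\<open>coord_domain\<close> away from the null set \<open>r = 0\<close>, so the
  Riemannian volume of a set of points can be computed in this single chart.
\<close>
definition vol :: "point set \<Rightarrow> real" where
  "vol S = measure (density lborel (\<lambda>p. ennreal (volume_element p)))
             {p \<in> coord_domain. hyp p \<in> S}"

definition base_plane :: "point set" where
  "base_plane = hyp ` {(r, \<theta>, \<phi>) \<in> coord_domain. \<phi> = 0}"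

definition disc :: "real \<Rightarrow> point set" where
  "disc r = {hyp (t, \<theta>, 0) | t \<theta>. 0 \<le> t \<and> t \<le> r \<and> -pi < \<theta> \<and> \<theta> \<le> pi}"

lemma disc_subset_base_plane: "disc r \<subseteq> base_plane"
  by (auto simp: disc_def base_plane_def coord_domain_def)

definition unit_solid :: "point set \<Rightarrow> point set" where
  "unit_solid D = {hyp (t, \<theta>, \<phi>) | t \<theta> \<phi>.
     (t, \<theta>, \<phi>) \<in> coord_domain \<and> hyp (t, \<theta>, 0) \<in> D \<and> 0 \<le> \<phi> \<and> \<phi> \<le> 1}"

text \<open>The area of a region \<open>D \<subseteq> base_plane\<close>.\<close>
definition area :: "point set \<Rightarrow> real" where
  "area D = vol (unit_solid D)"

end

theory Submission
  imports Defs
begin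

text \<open>In coordinates, the solid of height 1 over the disc is the box with radius in [0, r],
  angle in (-\<pi>, \<pi>] and fibre angle in [0, 1] (\<open>unit_solid_disc_coords\<close>). The
  volume density sinh(2t)/2 depends on the radius alone, so by Tonelli the angle and fibre
  contribute a factor 2\<pi>, leaving \<pi> times the integral of sinh(2t). This integral is
  elementary, as sinh(2t) is the derivative of the square of sinh t
  (\<open>has_integral_sinh_double\<close>).\<close>

lemma volume_element_eq_abs:
  "volume_element (r, \<theta>, \<phi>) = \<bar>sinh (2 * r) / 2\<bar>"
proof -
  have "det (metric_matrix (r, \<theta>, \<phi>)) = (cosh r * sinh r)\<^sup>2"
    by (simp add: det_3 metric_matrix_def metric_def coord_frame_def power_mult_distrib)
  then show ?thesis
    by (simp add: volume_element_def sinh_double abs_mult)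
qed

text \<open>The absolute value makes the formula valid for negative radii too, so the density is
  continuous on the whole coordinate space.\<close>

lemma borel_measurable_volume_element [measurable]: "volume_element \<in> borel_measurable borel"
proof -
  have "volume_element = (\<lambda>p. \<bar>sinh (2 * fst p) / 2\<bar>)"
    by (auto simp: fun_eq_iff volume_element_eq_abs)
  moreover have "continuous_on UNIV (\<lambda>p :: coords. \<bar>sinh (2 * fst p) / 2\<bar>)"
    by (intro continuous_intros) auto
  ultimately show ?thesis
    by (metis borel_measurable_continuous_onI)
qed

lemma unit_solid_disc_coords:
  "{p \<in> coord_domain. hyp p \<in> unit_solid (disc r)} = {0..r} \<times> {-pi<..pi} \<times> {0..1}"
proof (intro set_eqI iffI)
  fix p assume "p \<in> {p \<in> coord_domain. hyp p \<in> unit_solid (disc r)}"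
  then obtain t \<theta> \<phi> t' \<theta>' \<phi>' s \<psi> where *: "p = (t, \<theta>, \<phi>)" "p \<in> coord_domain"
    "hyp (t, \<theta>, \<phi>) = hyp (t', \<theta>', \<phi>')" "(t', \<theta>', \<phi>') \<in> coord_domain" "0 \<le> \<phi>'" "\<phi>' \<le> 1"
    "hyp (t', \<theta>', 0) = hyp (s, \<psi>, 0)" "0 \<le> s" "s \<le> r"
    by (cases p) (auto simp: unit_solid_def disc_def)
  \<comment> \<open>The angle need not be recoverable, since \<open>hyp\<close> forgets it at radius
    0. Radius and fibre angle suffice, because the box contains every admissible angle.\<close>
  have "t = t'" "\<phi> = \<phi>'" "t' = s"
    using hyp_eqD[OF *(3)] hyp_eqD[OF *(7)] * by (auto simp: coord_domain_def)
  then show "p \<in> {0..r} \<times> {-pi<..pi} \<times> {0..1}"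
    using * by (auto simp: coord_domain_def)
next
  fix p assume "p \<in> {0..r} \<times> {-pi<..pi} \<times> {0..1::real}"
  then show "p \<in> {p \<in> coord_domain. hyp p \<in> unit_solid (disc r)}"
    by (auto simp: coord_domain_def unit_solid_def disc_def) blast
qed

lemma has_integral_sinh_double:
  fixes r :: real
  assumes "0 \<le> r"
  shows "((\<lambda>t. sinh (2 * t)) has_integral (sinh r)\<^sup>2) {0..r}"
proof -
  have "((\<lambda>t. (sinh t)\<^sup>2) has_vector_derivative sinh (2 * t)) (at t within {0..r})" for t :: real
    unfolding has_real_derivative_iff_has_vector_derivative[symmetric]
    by (auto intro!: derivative_eq_intros simp: sinh_double)
  from fundamental_theorem_of_calculus[OF assms this] show ?thesis
    by simp
qed

lemma area_disc:
  assumes "0 \<le> r"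
  shows "area (disc r) = pi * (sinh r)\<^sup>2"
proof -
  let ?B = "{-pi<..pi} \<times> {0..1::real}"
  have B: "emeasure lborel ?B = ennreal (2 * pi)"
    unfolding lborel_prod[symmetric]
    by (subst lborel.emeasure_pair_measure_Times) auto
  have [measurable]: "?B \<in> sets borel"
    unfolding borel_prod[symmetric] by measurable
  have A [measurable]: "{0..r} \<times> ?B \<in> sets borel"
    unfolding borel_prod[symmetric] by (intro pair_measureI) (auto simp: borel_prod)
  \<comment> \<open>Tonelli, with the radius split off from the pair of angle and fibre
    coordinate.\<close>
  have "(\<integral>\<^sup>+p. ennreal (volume_element p) * indicator ({0..r} \<times> ?B) p \<partial>lborel)
      = (\<integral>\<^sup>+t. \<integral>\<^sup>+q. ennreal (volume_element (t, q)) * indicator ({0..r} \<times> ?B) (t, q) \<partial>lborel \<partial>lborel)"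
    unfolding lborel_prod[symmetric, where ?'a = real and ?'b = "real \<times> real"]
    by (rule lborel.nn_integral_fst[symmetric]) (unfold lborel_prod, measurable)
  also have "\<dots> = (\<integral>\<^sup>+t. \<integral>\<^sup>+q. ennreal (sinh (2 * t) / 2) * indicator {0..r} t * indicator ?B q \<partial>lborel \<partial>lborel)"
    by (intro nn_integral_cong) (auto simp: volume_element_eq split: split_indicator)
  also have "\<dots> = (\<integral>\<^sup>+t. ennreal (2 * pi) * (ennreal (sinh (2 * t) / 2) * indicator {0..r} t) \<partial>lborel)"
    by (subst nn_integral_cmult_indicator) (simp_all add: B mult.commute)
  \<comment> \<open>Extending by 0 off [0, r] keeps the integrand nonnegative on the whole line, as
    needed to pass to the gauge integral.\<close>
  also have "\<dots> = (\<integral>\<^sup>+t. ennreal (if t \<in> {0..r} then pi * sinh (2 * t) else 0) \<partial>lborel)"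
    by (intro nn_integral_cong) (auto simp: ennreal_mult'[symmetric] split: split_indicator)
  also have "\<dots> = ennreal (pi * (sinh r)\<^sup>2)"
  proof (rule nn_integral_has_integral_lborel)
    have "continuous_on UNIV (\<lambda>t::real. pi * sinh (2 * t))"
      by (intro continuous_intros)
    then have [measurable]: "(\<lambda>t::real. pi * sinh (2 * t)) \<in> borel_measurable borel"
      by (rule borel_measurable_continuous_onI)
    show "(\<lambda>t. if t \<in> {0..r} then pi * sinh (2 * t) else 0) \<in> borel_measurable borel"
      by measurable
    show "((\<lambda>t. if t \<in> {0..r} then pi * sinh (2 * t) else 0) has_integral pi * (sinh r)\<^sup>2) UNIV"
      unfolding has_integral_restrict_UNIV
      by (rule has_integral_mult_right[OF has_integral_sinh_double[OF assms]])
  qed auto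
  finally show ?thesis
    using A by (simp add: area_def vol_def unit_solid_disc_coords measure_def emeasure_density)
qed

theorem lemma4p4:
  fixes r :: real
  assumes "r > 0"
  shows "area (disc r) = pi * integral {0..r} (\<lambda>t. sinh (2 * t))
       \<and> pi * integral {0..r} (\<lambda>t. sinh (2 * t)) = pi * (sinh r)\<^sup>2"
  using area_disc has_integral_sinh_double[THEN integral_unique] assms by simp

end
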